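(* Let $\omega=e^{2\pi i/3}$. Every $3$-and-$3$ form of prime index $\ell$ is equivalent, up to orthogonal transformations and homotheties, to $(L,M)=(\mathbb{Z}[\omega],\mathfrak{p}_\ell)$, where $\mathfrak{p}_\ell$ is a prime ideal of $\mathbb{Z}[\omega]$ over $\ell$ and $\ell=3$ or $\ell\equiv1\bmod6$.
   Context: A lattice in $\mathbb{R}^2\cong\mathbb{C}$ is the $\mathbb{Z}$-span of an $\mathbb{R}$-basis; $\langle\,,\rangle$ is the standard dot product; a homothety is multiplication by a positive real scalar. Let $\ell$ be a prime, $L$ a lattice and $M\subset L$ a sublattice of index $\ell$. The pair $(L,M)$ is a tempered perfect lattice (or form) of index $\ell$ if, after rescaling $L$ and $M$ by a common positive scalar, there exist non-empty sets $S\subset L-M$ and $S'\subset M-\{0\}$ such that, with $A(v)=\langle v,v\rangle$: (i) $A(v)=1$ for all $v\in S$; (ii) $A(v)>1$ for all $v\in L-M$ with $v\notin S$; (iii) $A(v)$ has a common value $u\geqslant 1$ for all $v\in S'$; (iv) $A(v)>u$ for all $v\in M-\{0\}$ with $v\notin S'$; (v) if $B$ is any positive definite quadratic form on $\mathbb{R}^2$ satisfying (i)--(iv) in place of $A$ with the same $S,S'$ and with common value $u'$ on $S'$, then $B=A$ and $u'=u$. It is called an $s$-and-$s'$ form if $S$ consists of $s$ pairs $\pm v$ and $S'$ consists of $s'$ pairs $\pm v$. *)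

theory Defs
  imports
    "HOL-Analysis.Analysis"
    "HOL-Computational_Algebra.Primes"
    "HOL-Number_Theory.Cong"
    "HOL-Algebra.Ideal"
begin

text \<open>
  The plane is the type \<^typ>\<open>complex\<close> with its real inner product
  \<open>v \<bullet> w = Re v * Re w + Im v * Im w\<close>, which is the standard dot product.
\<close>

definition is_lattice :: "complex set \<Rightarrow> bool" where
  "is_lattice L \<longleftrightarrow>
    (\<exists>b1 b2. b1 \<noteq> b2 \<and> independent {b1, b2} \<and> span {b1, b2} = UNIV \<and>
      L = {of_int m *\<^sub>R b1 + of_int n *\<^sub>R b2 | m n. True})"

definition additive_group :: "complex set \<Rightarrow> complex monoid" where
  "additive_group L = \<lparr>carrier = L, monoid.mult = (+), one = 0\<rparr>"

text \<open>
  \<^const>\<open>card\<close> is 0 on infinite sets, so this means what it should only for \<open>l > 0\<close>.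
\<close>

definition sublattice_of_index :: "nat \<Rightarrow> complex set \<Rightarrow> complex set \<Rightarrow> bool" where
  "sublattice_of_index l L M \<longleftrightarrow>
    is_lattice L \<and> is_lattice M \<and> M \<subseteq> L \<and> card (rcosets\<^bsub>additive_group L\<^esub> M) = l"

definition pos_def_quadratic_form :: "(complex \<Rightarrow> real) \<Rightarrow> bool" where
  "pos_def_quadratic_form Q \<longleftrightarrow>
    (\<exists>b. bilinear b \<and> (\<forall>v w. b v w = b w v) \<and> (\<forall>v. Q v = b v v)) \<and>
    (\<forall>v. v \<noteq> 0 \<longrightarrow> Q v > 0)"

definition tempered_minima ::
    "complex set \<Rightarrow> complex set \<Rightarrow> complex set \<Rightarrow> complex set \<Rightarrow> (complex \<Rightarrow> real) \<Rightarrow> real \<Rightarrow> bool" where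
  "tempered_minima L M S S' Q u \<longleftrightarrow>
    (\<forall>v\<in>S. Q v = 1) \<and>
    (\<forall>v\<in>L - M. v \<notin> S \<longrightarrow> Q v > 1) \<and>
    u \<ge> 1 \<and> (\<forall>v\<in>S'. Q v = u) \<and>
    (\<forall>v\<in>M - {0}. v \<notin> S' \<longrightarrow> Q v > u)"

text \<open>Already rescaled pairs, together with the sets \<open>S\<close>, \<open>S'\<close> of minimal vectors.\<close>

definition tempered_perfect_normalized ::
    "complex set \<Rightarrow> complex set \<Rightarrow> complex set \<Rightarrow> complex set \<Rightarrow> bool" where
  "tempered_perfect_normalized L M S S' \<longleftrightarrow>
    S \<noteq> {} \<and> S \<subseteq> L - M \<and> S' \<noteq> {} \<and> S' \<subseteq> M - {0} \<and>
    (\<exists>u. tempered_minima L M S S' (\<lambda>v. v \<bullet> v) u \<and>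
      (\<forall>B u'. pos_def_quadratic_form B \<and> tempered_minima L M S S' B u'
         \<longrightarrow> B = (\<lambda>v. v \<bullet> v) \<and> u' = u))"

definition tempered_perfect :: "nat \<Rightarrow> complex set \<Rightarrow> complex set \<Rightarrow> bool" where
  "tempered_perfect l L M \<longleftrightarrow>
    sublattice_of_index l L M \<and>
    (\<exists>c>0. \<exists>S S'. tempered_perfect_normalized ((*\<^sub>R) c ` L) ((*\<^sub>R) c ` M) S S')"

text \<open>\<open>S\<close> is the disjoint union of \<open>s\<close> pairs \<open>\<plusminus>v\<close>, for \<open>S\<close> not containing 0.\<close>

definition consists_of_pairs :: "nat \<Rightarrow> complex set \<Rightarrow> bool" where
  "consists_of_pairs s S \<longleftrightarrow>
    finite S \<and> uminus ` S = S \<and> card ((\<lambda>v. {v, - v}) ` S) = s"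

text \<open>
  The scalar and the sets \<open>S\<close>, \<open>S'\<close> below are determined by the pair \<open>(L, M)\<close>: the squared
  lengths of the vectors of \<open>L - M\<close> have minimum 1 after rescaling, attained exactly on \<open>S\<close>, and
  \<open>S'\<close> consists of the shortest non-zero vectors of \<open>M\<close>.
\<close>

definition s_and_s'_form :: "nat \<Rightarrow> nat \<Rightarrow> nat \<Rightarrow> complex set \<Rightarrow> complex set \<Rightarrow> bool" where
  "s_and_s'_form s s' l L M \<longleftrightarrow>
    sublattice_of_index l L M \<and>
    (\<exists>c>0. \<exists>S S'. tempered_perfect_normalized ((*\<^sub>R) c ` L) ((*\<^sub>R) c ` M) S S' \<and>
      consists_of_pairs s S \<and> consists_of_pairs s' S')"

lemma s_and_s'_form_imp_tempered_perfect:
  "s_and_s'_form s s' l L M \<Longrightarrow> tempered_perfect l L M"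
  unfolding s_and_s'_form_def tempered_perfect_def by blast

definition equivalent_pairs ::
    "complex set \<times> complex set \<Rightarrow> complex set \<times> complex set \<Rightarrow> bool" where
  "equivalent_pairs = (\<lambda>(L, M) (L', M').
    \<exists>T c. orthogonal_transformation T \<and> c > 0 \<and>
      (\<lambda>v. T (c *\<^sub>R v)) ` L = L' \<and> (\<lambda>v. T (c *\<^sub>R v)) ` M = M')"

definition omega :: complex where
  "omega = exp (2 * of_real pi * \<i> / 3)"

definition eisenstein_integers :: "complex set" where
  "eisenstein_integers = {of_int a + of_int b * omega | a b. True}"

definition eisenstein_ring :: "complex ring" where
  "eisenstein_ring =
    \<lparr>carrier = eisenstein_integers, monoid.mult = (*), one = 1, zero = 0, add = (+)\<rparr>"

lemma omega_squared: "omega * omega = - 1 - omega"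
proof -
  have "omega = cis (2 * pi / 3)"
    by (simp add: omega_def cis_conv_exp mult_ac)
  then have omega: "omega = Complex (- 1 / 2) (sqrt 3 / 2)"
    by (simp add: complex_eq_iff cos_120 sin_120)
  show ?thesis
    unfolding omega by (simp add: complex_eq_iff)
qed

lemma cring_eisenstein_ring: "cring eisenstein_ring"
proof -
  have add: "x + y \<in> eisenstein_integers"
    if "x \<in> eisenstein_integers" "y \<in> eisenstein_integers" for x y
  proof -
    from that obtain a b c d where
      "x = of_int a + of_int b * omega" "y = of_int c + of_int d * omega"
      unfolding eisenstein_integers_def by blast
    then have "x + y = of_int (a + c) + of_int (b + d) * omega"
      by (simp add: algebra_simps)
    then show ?thesis unfolding eisenstein_integers_def by blast
  qed
  have mult: "x * y \<in> eisenstein_integers"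
    if "x \<in> eisenstein_integers" "y \<in> eisenstein_integers" for x y
  proof -
    from that obtain a b c d where xy:
      "x = of_int a + of_int b * omega" "y = of_int c + of_int d * omega"
      unfolding eisenstein_integers_def by blast
    have "x * y = of_int a * of_int c + (of_int a * of_int d + of_int b * of_int c) * omega
        + of_int b * of_int d * (omega * omega)"
      unfolding xy by (simp add: algebra_simps)
    also have "\<dots> = of_int (a * c - b * d) + of_int (a * d + b * c - b * d) * omega"
      unfolding omega_squared by (simp add: algebra_simps)
    finally show ?thesis unfolding eisenstein_integers_def by blast
  qed
  have int: "of_int a \<in> eisenstein_integers" for a
  proof -
    have "of_int a = of_int a + of_int 0 * omega" by simp
    then show ?thesis unfolding eisenstein_integers_def by blast
  qed
  have uminus: "\<exists>y\<in>eisenstein_integers. y + x = 0" if "x \<in> eisenstein_integers" for x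
    using mult[OF int[of "- 1"] that] by force
  show ?thesis
    using int[of 0] int[of 1] uminus
    by (intro cringI abelian_groupI comm_monoidI)
       (auto simp: eisenstein_ring_def algebra_simps intro: add mult)
qed

definition prime_ideal_over :: "complex set \<Rightarrow> nat \<Rightarrow> bool" where
  "prime_ideal_over P l \<longleftrightarrow>
    primeideal P eisenstein_ring \<and> P \<inter> \<int> = {of_int (int l * k) | k. True}"

end

theory Submission
  imports Defs "HOL-Algebra.Multiplicative_Group" "HOL-Number_Theory.Residues"
begin

text \<open>
  A planar lattice with three pairs of minimal vectors is hexagonal, that is, of the form
  \<open>\<alpha>\<cdot>\<int>[\<omega>]\<close>: vectors of minimal length differ by angles of at least 60 degrees, so six of them
  form a regular hexagon. This applies to both \<open>L\<close> and \<open>M\<close>; after dividing by the generator of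
  \<open>L\<close>, the lattice \<open>M\<close> becomes an ideal of \<open>\<int>[\<omega>]\<close> of prime index \<open>l\<close>. The quotient being
  generated by 1, there is an integer \<open>t\<close> with \<open>\<omega> \<equiv> t\<close> modulo \<open>M\<close>, whence \<open>l\<close> divides
  \<open>t\<^sup>2 + t + 1\<close>.
\<close>

section \<open>Coordinates on the Eisenstein integers\<close>

lemma omega_eq: "omega = Complex (- 1 / 2) (sqrt 3 / 2)"
proof -
  have "omega = cis (2 * pi / 3)"
    by (simp add: omega_def cis_conv_exp mult_ac)
  then show ?thesis by (simp add: complex_eq_iff cos_120 sin_120)
qed

lemma inner_omega_combination:
  "(of_real x + of_real y * omega) \<bullet> (of_real x + of_real y * omega) = x\<^sup>2 - x * y + y\<^sup>2"
proof -
  have "sqrt 3 * sqrt 3 = (3::real)" by simp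
  then show ?thesis
    by (simp add: omega_eq inner_complex_def power2_eq_square algebra_simps)
qed

lemma closed_of_nat_mult:
  fixes N :: "complex set"
  assumes "0 \<in> N" "\<And>x y. x \<in> N \<Longrightarrow> y \<in> N \<Longrightarrow> x + y \<in> N" "x \<in> N"
  shows "of_nat k * x \<in> N"
  using assms by (induction k) (auto simp: algebra_simps)

lemma closed_of_int_mult:
  fixes N :: "complex set"
  assumes "0 \<in> N" "\<And>x y. x \<in> N \<Longrightarrow> y \<in> N \<Longrightarrow> x + y \<in> N"
    "\<And>x. x \<in> N \<Longrightarrow> - x \<in> N" "x \<in> N"
  shows "of_int k * x \<in> N"
proof (cases k)
  case (nonneg n)
  then show ?thesis using closed_of_nat_mult[of N x n] assms by simp
next
  case (neg n)
  then have "of_int k * x = - (of_nat (Suc n) * x)"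
    by (simp only: of_int_minus of_int_of_nat_eq minus_mult_left)
  then show ?thesis using assms(3)[OF closed_of_nat_mult[of N x "Suc n"]] assms by metis
qed

text \<open>Rounding both coordinates with respect to 1 and \<open>omega\<close> leaves errors a, b
  of size at most 1/2, and then a^2 - a*b + b^2 is at most 3/4. This is the division property that
  makes the Eisenstein integers norm-Euclidean.\<close>

lemma eisenstein_approximation:
  obtains w where "w \<in> eisenstein_integers" "(z - w) \<bullet> (z - w) < 1"
proof -
  \<comment> \<open>As \<open>omega\<close> has real part -1/2 and imaginary part sqrt 3 / 2, these
    are the coordinates of \<open>z\<close> with respect to 1 and \<open>omega\<close>.\<close>
  define y where "y = Im z * 2 / sqrt 3"
  define x where "x = Re z + y / 2"
  have z: "z = of_real x + of_real y * omega"
    by (simp add: omega_eq complex_eq_iff x_def y_def)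
  define a where "a = x - of_int (round x)"
  define b where "b = y - of_int (round y)"
  have ab: "\<bar>a\<bar> \<le> 1/2" "\<bar>b\<bar> \<le> 1/2"
    unfolding a_def b_def
    using of_int_round_abs_le[of x] of_int_round_abs_le[of y] by linarith+
  have "a\<^sup>2 \<le> 1/4" "b\<^sup>2 \<le> 1/4"
    using ab abs_le_square_iff[of a "1/2"] abs_le_square_iff[of b "1/2"]
    by (simp_all add: power2_eq_square)
  moreover have "\<bar>a * b\<bar> \<le> 1/2 * (1/2)"
    unfolding abs_mult using ab by (intro mult_mono) auto
  ultimately have "a\<^sup>2 - a * b + b\<^sup>2 < 1" by linarith
  moreover have "z - (of_int (round x) + of_int (round y) * omega) = of_real a + of_real b * omega"
    by (simp add: z a_def b_def algebra_simps)
  ultimately have "(z - (of_int (round x) + of_int (round y) * omega)) \<bullet>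
      (z - (of_int (round x) + of_int (round y) * omega)) < 1"
    by (simp only: inner_omega_combination)
  then show ?thesis using that unfolding eisenstein_integers_def by blast
qed

section \<open>Minimal vectors and hexagonal lattices\<close>

text \<open>The two squared lengths expand to 2 - 2c and 2 + 2c with c the inner product.
  Geometrically, the lines through \<open>v\<close> and \<open>w\<close> meet at an angle of at
  least 60 degrees.\<close>

lemma unit_vectors_inner_bound:
  fixes v w :: "'a::real_inner"
  assumes "v \<bullet> v = 1" "w \<bullet> w = 1" "(v - w) \<bullet> (v - w) \<ge> 1" "(v + w) \<bullet> (v + w) \<ge> 1"
  shows "\<bar>v \<bullet> w\<bar> \<le> 1/2"
  using assms by (auto simp: inner_simps inner_commute)

text \<open>Both points lie on the arc of the unit circle from 60 to 120 degrees and are at least 60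
  degrees apart. Hence they are the two ends of the arc, and the end at 120 degrees is
  \<open>omega\<close>.\<close>

lemma two_unit_vectors_upper_half_plane:
  fixes x y x' y' :: real
  assumes unit: "x\<^sup>2 + y\<^sup>2 = 1" "x'\<^sup>2 + y'\<^sup>2 = 1"
    and bound: "\<bar>x\<bar> \<le> 1/2" "\<bar>x'\<bar> \<le> 1/2" "x * x' + y * y' \<le> 1/2"
    and pos: "y \<ge> 0" "y' \<ge> 0"
  shows "x = - 1/2 \<and> y = sqrt 3 / 2 \<or> x' = - 1/2 \<and> y' = sqrt 3 / 2"
proof -
  have "x\<^sup>2 \<le> 1/4" "x'\<^sup>2 \<le> 1/4"
    using bound abs_le_square_iff[of x "1/2"] abs_le_square_iff[of x' "1/2"]
    by (simp_all add: power2_eq_square)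
  then have "(sqrt 3 / 2)\<^sup>2 \<le> y\<^sup>2" "(sqrt 3 / 2)\<^sup>2 \<le> y'\<^sup>2"
    using unit by (simp_all add: power_divide)
  then have y: "sqrt 3 / 2 \<le> y" "sqrt 3 / 2 \<le> y'"
    using pos power2_le_imp_le by blast+
  have "sqrt 3 / 2 * (sqrt 3 / 2) \<le> y * y'"
    using y pos by (intro mult_mono) auto
  \<comment> \<open>Since also \<bar>x\<bar> and \<bar>x'\<bar> are at most 1/2, the product is at
    least -1/4. So equality holds throughout, with opposite signs.\<close>
  then have "x * x' \<le> - 1/4" using bound by simp
  moreover have "\<bar>x * x'\<bar> \<le> \<bar>x\<bar> * (1/2)" "\<bar>x * x'\<bar> \<le> 1/2 * \<bar>x'\<bar>"
    unfolding abs_mult using bound(1,2) by (intro mult_left_mono mult_right_mono; simp)+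
  ultimately have abs: "\<bar>x\<bar> = 1/2" "\<bar>x'\<bar> = 1/2" and neg: "x * x' < 0"
    using bound by linarith+
  have "x\<^sup>2 = 1/4" "x'\<^sup>2 = 1/4"
    unfolding power2_abs[of x, symmetric] power2_abs[of x', symmetric] abs
    by (simp_all add: power_divide)
  then have "y\<^sup>2 = (sqrt 3 / 2)\<^sup>2" "y'\<^sup>2 = (sqrt 3 / 2)\<^sup>2"
    using unit by (simp_all add: power_divide)
  then have "y = sqrt 3 / 2" "y' = sqrt 3 / 2"
    using pos power2_eq_imp_eq[of y "sqrt 3 / 2"] power2_eq_imp_eq[of y' "sqrt 3 / 2"] by simp_all
  moreover have "x = - 1/2 \<or> x' = - 1/2"
    using abs neg by (cases "x < 0"; cases "x' < 0") (auto simp: mult_less_0_iff)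
  ultimately show ?thesis by blast
qed

text \<open>Since the pairs of 1, \<open>v\<close> and \<open>w\<close> are distinct, their sums and
  differences are non-zero elements of \<open>N\<close>, so \<open>min\<close> bounds them below and
  all angles are at least 60 degrees. The third pair is what forces an element at exactly 120
  degrees from 1.\<close>

lemma omega_mem_if_three_unit_pairs:
  assumes closed: "\<And>x y. x \<in> N \<Longrightarrow> y \<in> N \<Longrightarrow> x + y \<in> N" "\<And>x. x \<in> N \<Longrightarrow> - x \<in> N"
    and min: "\<And>v. v \<in> N \<Longrightarrow> v \<noteq> 0 \<Longrightarrow> v \<bullet> v \<ge> 1"
    and "1 \<in> N" and v: "v \<in> N" "v \<bullet> v = 1" and w: "w \<in> N" "w \<bullet> w = 1"
    and ne: "v \<noteq> 1" "v \<noteq> - 1" "w \<noteq> 1" "w \<noteq> - 1" "v \<noteq> w" "v \<noteq> - w"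
  shows "omega \<in> N"
proof -
  have bound: "\<bar>a \<bullet> b\<bar> \<le> 1/2"
    if "a \<in> N" "b \<in> N" "a \<bullet> a = 1" "b \<bullet> b = 1" "a \<noteq> b" "a \<noteq> - b" for a b
  proof (rule unit_vectors_inner_bound)
    show "(a - b) \<bullet> (a - b) \<ge> 1"
      using min[of "a - b"] closed(1)[OF that(1) closed(2)[OF that(2)]] that by auto
    show "(a + b) \<bullet> (a + b) \<ge> 1"
      using min[of "a + b"] closed(1)[OF that(1,2)] that by (auto simp: eq_neg_iff_add_eq_0)
  qed (use that in auto)
  \<comment> \<open>From each pair the member in the closed upper half-plane is taken, where
    \<open>omega\<close> lies.\<close>
  define v' where "v' = (if Im v \<ge> 0 then v else - v)"
  define w' where "w' = (if Im w \<ge> 0 then w else - w)"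
  have v': "v' \<in> N" "v' \<bullet> v' = 1" "v' \<noteq> 1" "v' \<noteq> - 1" "Im v' \<ge> 0"
    using v ne closed unfolding v'_def by (auto simp: minus_equation_iff)
  have w': "w' \<in> N" "w' \<bullet> w' = 1" "w' \<noteq> 1" "w' \<noteq> - 1" "Im w' \<ge> 0"
    using w ne closed unfolding w'_def by (auto simp: minus_equation_iff)
  have ne': "v' \<noteq> w'" "v' \<noteq> - w'"
    using ne unfolding v'_def w'_def by (auto simp: minus_equation_iff)
  have "\<bar>Re v' * Re w' + Im v' * Im w'\<bar> \<le> 1/2"
    using bound[OF v'(1) w'(1) v'(2) w'(2) ne'] by (simp add: inner_complex_def)
  then have "Re v' * Re w' + Im v' * Im w' \<le> 1/2" by linarith
  then have "Re v' = - 1/2 \<and> Im v' = sqrt 3 / 2 \<or> Re w' = - 1/2 \<and> Im w' = sqrt 3 / 2"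
    using bound[of v' 1] bound[of w' 1] v' w' \<open>1 \<in> N\<close>
    by (intro two_unit_vectors_upper_half_plane)
       (auto simp: inner_complex_def power2_eq_square)
  then have "v' = omega \<or> w' = omega" by (auto simp: omega_eq complex_eq_iff)
  then show ?thesis using v' w' by auto
qed

lemma inner_mult_complex:
  fixes a z :: complex
  shows "(a * z) \<bullet> (a * z) = (a \<bullet> a) * (z \<bullet> z)"
  by (simp add: inner_complex_def algebra_simps)

text \<open>Dividing by a minimal vector \<open>\<alpha>\<close> gives a group \<open>N'\<close>
  with minimum 1 that contains 1 and, by the three pairs, \<open>omega\<close>. Nothing else fits:
  subtracting a nearby Eisenstein integer from an element of \<open>N'\<close> leaves a vector of
  squared length below 1, which must vanish.\<close>

lemma hexagonal_lattice:
  assumes zero: "0 \<in> N" and add: "\<And>x y. x \<in> N \<Longrightarrow> y \<in> N \<Longrightarrow> x + y \<in> N"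
    and neg: "\<And>x. x \<in> N \<Longrightarrow> - x \<in> N"
    and min: "\<And>v. v \<in> N \<Longrightarrow> v \<noteq> 0 \<Longrightarrow> v \<bullet> v \<ge> m" and "m > 0"
    and S: "S \<subseteq> N" "\<And>v. v \<in> S \<Longrightarrow> v \<bullet> v = m" "consists_of_pairs 3 S"
  obtains \<alpha> where "\<alpha> \<noteq> 0" "N = (*) \<alpha> ` eisenstein_integers"
proof -
  have "card ((\<lambda>v. {v, - v}) ` S) = 3" using S(3) by (simp add: consists_of_pairs_def)
  then obtain X Y Z where XYZ: "(\<lambda>v. {v, - v}) ` S = {X, Y, Z}" "X \<noteq> Y" "Y \<noteq> Z" "X \<noteq> Z"
    by (auto simp: card_3_iff)
  then have "X \<in> (\<lambda>v. {v, - v}) ` S" "Y \<in> (\<lambda>v. {v, - v}) ` S" "Z \<in> (\<lambda>v. {v, - v}) ` S"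
    by auto
  then obtain \<alpha> v w where vw: "X = {\<alpha>, - \<alpha>}" "Y = {v, - v}" "Z = {w, - w}" "\<alpha> \<in> S" "v \<in> S" "w \<in> S"
    by blast
  have ne: "v \<noteq> \<alpha>" "v \<noteq> - \<alpha>" "w \<noteq> \<alpha>" "w \<noteq> - \<alpha>" "v \<noteq> w" "v \<noteq> - w"
    using XYZ(2-4) unfolding vw by (auto simp: insert_commute)
  have \<alpha>: "\<alpha> \<noteq> 0" "\<alpha> \<bullet> \<alpha> = m" using S(2)[OF vw(4)] \<open>m > 0\<close> by auto
  define N' where "N' = {z. \<alpha> * z \<in> N}"
  have zero': "0 \<in> N'" using zero by (simp add: N'_def)
  have add': "x + y \<in> N'" if "x \<in> N'" "y \<in> N'" for x y
    using add that by (simp add: N'_def distrib_left)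
  have neg': "- x \<in> N'" if "x \<in> N'" for x
    using neg that by (simp add: N'_def)
  have min': "z \<bullet> z \<ge> 1" if "z \<in> N'" "z \<noteq> 0" for z
  proof -
    have "m \<le> m * (z \<bullet> z)"
      using min[of "\<alpha> * z"] that \<alpha> by (simp add: N'_def inner_mult_complex)
    then show ?thesis using \<open>m > 0\<close> by simp
  qed
  have unit: "z / \<alpha> \<in> N'" "(z / \<alpha>) \<bullet> (z / \<alpha>) = 1" if "z \<in> S" for z
    using inner_mult_complex[of \<alpha> "z / \<alpha>"] that S(1) S(2)[OF that] \<alpha> \<open>m > 0\<close>
    by (auto simp: N'_def)
  have one': "1 \<in> N'" using S(1) vw(4) by (auto simp: N'_def)
  have "omega \<in> N'"
    by (rule omega_mem_if_three_unit_pairs[where v = "v / \<alpha>" and w = "w / \<alpha>"])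
       (use add' neg' min' one' unit vw ne \<alpha> in \<open>auto simp: field_simps\<close>)
  have int_mult: "of_int k * x \<in> N'" if "x \<in> N'" for k x
    using zero' add' neg' that by (rule closed_of_int_mult)
  have "of_int a + of_int b * omega \<in> N'" for a b
    using add'[OF int_mult[OF one', of a] int_mult[OF \<open>omega \<in> N'\<close>, of b]] by simp
  then have sub: "eisenstein_integers \<subseteq> N'"
    unfolding eisenstein_integers_def by blast
  have "N' \<subseteq> eisenstein_integers"
  proof
    fix z assume z: "z \<in> N'"
    obtain w where w: "w \<in> eisenstein_integers" "(z - w) \<bullet> (z - w) < 1"
      by (rule eisenstein_approximation)
    then have "z - w \<in> N'" using add'[OF z neg'[of w]] sub by auto
    then have "z = w" using min'[of "z - w"] w by fastforce
    then show "z \<in> eisenstein_integers" using w by simp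
  qed
  with sub have N': "N' = eisenstein_integers" by blast
  have "N = (*) \<alpha> ` N'"
  proof
    show "N \<subseteq> (*) \<alpha> ` N'"
    proof
      fix z assume "z \<in> N"
      then have "z / \<alpha> \<in> N'" "z = \<alpha> * (z / \<alpha>)" using \<alpha> by (simp_all add: N'_def)
      then show "z \<in> (*) \<alpha> ` N'" by blast
    qed
  qed (auto simp: N'_def)
  with N' \<alpha> that show ?thesis by blast
qed

section \<open>Lattices as additive groups and quotients of prime index\<close>

lemma lattice_closed:
  assumes "is_lattice L"
  shows "0 \<in> L" and "x \<in> L \<Longrightarrow> y \<in> L \<Longrightarrow> x + y \<in> L" and "x \<in> L \<Longrightarrow> - x \<in> L"
proof -
  obtain b c where L: "L = {of_int m *\<^sub>R b + of_int n *\<^sub>R c | m n. True}"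
    using assms unfolding is_lattice_def by blast
  have mem: "of_int m *\<^sub>R b + of_int n *\<^sub>R c \<in> L" for m n unfolding L by blast
  show "0 \<in> L" using mem[of 0 0] by simp
  show "x + y \<in> L" if xy: "x \<in> L" "y \<in> L"
  proof -
    obtain m n m' n' where
      "x = of_int m *\<^sub>R b + of_int n *\<^sub>R c" "y = of_int m' *\<^sub>R b + of_int n' *\<^sub>R c"
      using xy unfolding L by blast
    then have "x + y = of_int (m + m') *\<^sub>R b + of_int (n + n') *\<^sub>R c"
      by (simp add: algebra_simps)
    then show ?thesis using mem by metis
  qed
  show "- x \<in> L" if x: "x \<in> L"
  proof -
    obtain m n where "x = of_int m *\<^sub>R b + of_int n *\<^sub>R c" using x unfolding L by blast
    then have "- x = of_int (- m) *\<^sub>R b + of_int (- n) *\<^sub>R c" by simp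
    then show ?thesis using mem by metis
  qed
qed

lemma scaled_lattice_closed:
  assumes "is_lattice L"
  shows "0 \<in> (*\<^sub>R) c ` L"
    and "x \<in> (*\<^sub>R) c ` L \<Longrightarrow> y \<in> (*\<^sub>R) c ` L \<Longrightarrow> x + y \<in> (*\<^sub>R) c ` L"
    and "x \<in> (*\<^sub>R) c ` L \<Longrightarrow> - x \<in> (*\<^sub>R) c ` L"
proof -
  note closed = lattice_closed[OF assms]
  show "0 \<in> (*\<^sub>R) c ` L" using closed(1) by force
  show "x + y \<in> (*\<^sub>R) c ` L" if "x \<in> (*\<^sub>R) c ` L" "y \<in> (*\<^sub>R) c ` L"
    using that closed(2) by (auto simp flip: scaleR_add_right)
  show "- x \<in> (*\<^sub>R) c ` L" if "x \<in> (*\<^sub>R) c ` L"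
    using that closed(3) by (auto simp flip: scaleR_minus_right)
qed

lemma additive_group_comm_group:
  assumes "0 \<in> L" "\<And>x y. x \<in> L \<Longrightarrow> y \<in> L \<Longrightarrow> x + y \<in> L" "\<And>x. x \<in> L \<Longrightarrow> - x \<in> L"
  shows "comm_group (additive_group L)"
proof (rule comm_groupI)
  show "\<exists>y\<in>carrier (additive_group L). y \<otimes>\<^bsub>additive_group L\<^esub> x = \<one>\<^bsub>additive_group L\<^esub>"
    if "x \<in> carrier (additive_group L)" for x
    using that assms(3) by (intro bexI[of _ "- x"]) (auto simp: additive_group_def)
qed (use assms in \<open>auto simp: additive_group_def algebra_simps\<close>)

text \<open>A group of prime order is generated by any element other than the identity, here by the
  coset of \<open>g\<close>. Lagrange's theorem gives the first claim, generation the
  second.\<close>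

lemma prime_index_cyclic_quotient:
  assumes L: "is_lattice L" and M: "is_lattice M" "M \<subseteq> L"
    and card: "card (rcosets\<^bsub>additive_group L\<^esub> M) = l" and l: "prime l"
    and g: "g \<in> L" "g \<notin> M"
  shows "of_nat l * g \<in> M" and "v \<in> L \<Longrightarrow> \<exists>k::nat. v - of_nat k * g \<in> M"
proof -
  let ?G = "additive_group L"
  note Lc = lattice_closed[OF L] and Mc = lattice_closed[OF M(1)]
  interpret G: comm_group ?G by (rule additive_group_comm_group) (use Lc in auto)
  have inv: "inv\<^bsub>?G\<^esub> x = - x" if "x \<in> L" for x
    using that Lc by (intro G.inv_equality) (auto simp: additive_group_def)
  have sub: "subgroup M ?G"
    using Mc M(2) inv by (intro G.subgroupI) (auto simp: additive_group_def)
  then interpret M: normal M ?G by (rule G.subgroup_imp_normal)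
  interpret Q: group "?G Mod M" by (rule M.factorgroup_is_group)
  have order: "order (?G Mod M) = l" using card by (simp add: order_def FactGroup_def)
  \<comment> \<open>An infinite quotient would have \<open>card\<close> equal to 0, which is not
    prime.\<close>
  have fin: "finite (carrier (?G Mod M))"
    using order l by (metis order_def card.infinite not_prime_0)
  have coset_mem: "x \<in> M #>\<^bsub>?G\<^esub> y \<longleftrightarrow> x - y \<in> M" for x y
    by (force simp: r_coset_def additive_group_def)
  have coset_eq: "x - y \<in> M" if "M #>\<^bsub>?G\<^esub> x = M #>\<^bsub>?G\<^esub> y" for x y
    using coset_mem[of x x] coset_mem[of x y] that Mc(1) by simp
  let ?c = "M #>\<^bsub>?G\<^esub> g"
  have c: "?c \<in> carrier (?G Mod M)"
    using g(1) by (auto simp: FactGroup_def RCOSETS_def additive_group_def)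
  have one: "\<one>\<^bsub>?G Mod M\<^esub> = M #>\<^bsub>?G\<^esub> 0"
    by (auto simp: FactGroup_def coset_mem)
  \<comment> \<open>The additive group is encoded multiplicatively, so powers in the quotient are
    cosets of multiples of \<open>g\<close>.\<close>
  have cpow: "?c [^]\<^bsub>?G Mod M\<^esub> (k::nat) = M #>\<^bsub>?G\<^esub> (of_nat k * g)" for k
  proof (induction k)
    case 0
    then show ?case using one by simp
  next
    case (Suc k)
    have "of_nat k * g \<in> L" using Lc(1) Lc(2) g(1) by (rule closed_of_nat_mult)
    then have "(M #>\<^bsub>?G\<^esub> (of_nat k * g)) <#>\<^bsub>?G\<^esub> ?c = M #>\<^bsub>?G\<^esub> (of_nat k * g + g)"
      using M.rcos_sum[of "of_nat k * g" g] g(1) by (simp add: additive_group_def)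
    then show ?case using Suc by (simp add: FactGroup_def algebra_simps)
  qed
  have "M #>\<^bsub>?G\<^esub> (of_nat l * g) = M #>\<^bsub>?G\<^esub> 0"
    using Q.pow_order_eq_1[OF c] unfolding order cpow one .
  from coset_eq[OF this] show "of_nat l * g \<in> M" by simp
  have "Q.ord ?c dvd l" using Q.ord_dvd_group_order[OF c] order by simp
  moreover have "Q.ord ?c \<noteq> 1"
  proof
    assume "Q.ord ?c = 1"
    then have "?c [^]\<^bsub>?G Mod M\<^esub> (1::nat) = \<one>\<^bsub>?G Mod M\<^esub>" using Q.pow_ord_eq_1[OF c] by simp
    then have "g - 0 \<in> M" unfolding cpow one using coset_eq[of "of_nat 1 * g" 0] by simp
    then show False using g by simp
  qed
  ultimately have ord: "Q.ord ?c = l" using l by (auto simp: prime_nat_iff)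
  \<comment> \<open>The powers of the coset form a subset with \<open>l\<close> elements of a set
    with \<open>l\<close> elements.\<close>
  have gen: "carrier (?G Mod M) = {?c [^]\<^bsub>?G Mod M\<^esub> k | k::nat. True}"
    using card_subset_eq[OF fin, of "{?c [^]\<^bsub>?G Mod M\<^esub> k | k::nat. True}"]
      Q.generate_pow_card[OF c] Q.generate_pow_on_finite_carrier[OF fin c] ord order c
    by (auto simp: order_def)
  show "\<exists>k::nat. v - of_nat k * g \<in> M" if "v \<in> L"
  proof -
    have "M #>\<^bsub>?G\<^esub> v \<in> carrier (?G Mod M)"
      using that by (auto simp: FactGroup_def RCOSETS_def additive_group_def)
    then obtain k :: nat where "M #>\<^bsub>?G\<^esub> v = ?c [^]\<^bsub>?G Mod M\<^esub> k" unfolding gen by blast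
    then show ?thesis using coset_eq cpow by metis
  qed
qed

section \<open>Primes dividing a value of the third cyclotomic polynomial\<close>

text \<open>As t^3 - 1 = (t - 1)(t^2 + t + 1), the residue of t = \<open>k\<close> has cube 1. If
  \<open>l\<close> is not 3, it is not 1 itself, so it has order 3, and by Fermat 3 divides
  \<open>l - 1\<close>. Oddness of \<open>l\<close> improves this to a congruence modulo 6.\<close>

lemma prime_dvd_cyclotomic3:
  fixes k :: nat
  assumes l: "prime l" and "int l dvd (int k)\<^sup>2 + int k + 1"
  shows "l = 3 \<or> [l = 1] (mod 6)"
proof (cases "l = 3")
  case False
  define t where "t = int k"
  have dvd: "int l dvd t\<^sup>2 + t + 1" using assms(2) by (simp add: t_def)
  have cube: "[t ^ 3 = 1] (mod int l)"
  proof -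
    have "t ^ 3 - 1 = (t - 1) * (t\<^sup>2 + t + 1)"
      by (simp add: power2_eq_square power3_eq_cube algebra_simps)
    then show ?thesis using dvd by (simp add: cong_iff_dvd_diff)
  qed
  have cop: "\<not> int l dvd t"
  proof
    assume "int l dvd t"
    then have "int l dvd t * (t + 1)" by simp
    moreover have "t\<^sup>2 + t + 1 = t * (t + 1) + 1" by (simp add: power2_eq_square algebra_simps)
    ultimately have "int l dvd 1" using dvd by (metis dvd_add_right_iff)
    then show False using l by (simp add: prime_nat_iff)
  qed
  have fermat: "[t ^ (l - 1) = 1] (mod int l)"
    using fermat_theorem[OF l, of k] cop cong_int_iff[of "k ^ (l - 1)" 1 l] by (simp add: t_def)
  have not1: "\<not> [t = 1] (mod int l)"
  proof
    assume a: "[t = 1] (mod int l)"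
    \<comment> \<open>At t = 1 the polynomial takes the value 3, so \<open>l\<close> would divide
      3.\<close>
    have "[t\<^sup>2 + t + 1 = 1\<^sup>2 + 1 + 1] (mod int l)"
      by (intro cong_add cong_pow a cong_refl)
    then have "int l dvd int 3" using dvd by (simp add: cong_dvd_iff)
    then have "l dvd 3" by (simp only: of_nat_dvd_iff)
    then show False using primes_dvd_imp_eq[OF l, of 3] False by simp
  qed
  \<comment> \<open>Exponents of t matter only modulo 3. This is applied to the exponent
    \<open>l - 1\<close> from Fermat's theorem, where either non-zero remainder would force t to be
    1 modulo \<open>l\<close>.\<close>
  have t_pow: "[t ^ (3 * q + r) = t ^ r] (mod int l)" for q r
    using cong_mult[OF cong_pow[OF cube, of q] cong_refl[of "t ^ r"]]
    by (simp add: power_add power_mult)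
  have "(l - 1) mod 3 = 0"
  proof (rule ccontr)
    assume "(l - 1) mod 3 \<noteq> 0"
    then consider "(l - 1) mod 3 = 1" | "(l - 1) mod 3 = 2" by linarith
    then show False
    proof cases
      case 1
      then show False using t_pow[of "(l - 1) div 3" 1] fermat not1
        by (metis cong_sym cong_trans mult_div_mod_eq power_one_right)
    next
      case 2
      then have "[t\<^sup>2 = 1] (mod int l)" using t_pow[of "(l - 1) div 3" 2] fermat
        by (metis cong_sym cong_trans mult_div_mod_eq)
      from cong_mult[OF cong_refl[of t] this] have "[t = 1] (mod int l)"
        using cube by (metis cong_sym cong_trans mult.right_neutral power2_eq_square power3_eq_cube mult.assoc)
      then show False using not1 by simp
    qed
  qed
  moreover have "odd l"
  proof
    assume "even l"
    \<comment> \<open>The sum t^2 + t = t(t + 1) is always even, so the dividend is odd.\<close>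
    then have "even (t\<^sup>2 + t + 1)" using dvd by (meson dvd_trans even_of_nat)
    then show False by simp
  qed
  ultimately have "l mod 6 = 1" using prime_gt_1_nat[OF l] by presburger
  then show ?thesis by (simp add: cong_def)
qed simp

section \<open>Prime ideals of the Eisenstein integers\<close>

text \<open>Modulo \<open>P\<close>, \<open>omega\<close> equals the integer \<open>t\<close>, so
  \<open>P\<close> is the kernel of the evaluation a + b omega -> a + b t modulo \<open>l\<close>.
  Its primality thus reduces to that of the integer \<open>l\<close>.\<close>

lemma prime_ideal_of_prime_index:
  assumes P: "P \<subseteq> eisenstein_integers" "0 \<in> P" "\<And>x y. x \<in> P \<Longrightarrow> y \<in> P \<Longrightarrow> x + y \<in> P"
    "\<And>x. x \<in> P \<Longrightarrow> - x \<in> P" "\<And>x. x \<in> P \<Longrightarrow> omega * x \<in> P"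
    and one: "1 \<notin> P" and l: "prime l" "of_nat l \<in> P"
    and omega: "omega - of_int t \<in> P"
  shows "prime_ideal_over P l" and "int l dvd t\<^sup>2 + t + 1"
proof -
  have int_mult: "of_int k * x \<in> P" if "x \<in> P" for k x
    using P(2-4) that by (rule closed_of_int_mult)
  have diff: "x - y \<in> P" if "x \<in> P" "y \<in> P" for x y
    using P(3)[OF that(1) P(4)[OF that(2)]] by simp
  have int_mem: "of_int k \<in> P \<longleftrightarrow> int l dvd k" for k
  proof
    assume "int l dvd k"
    then show "of_int k \<in> P" using int_mult[OF l(2)] by (auto simp: mult.commute elim!: dvdE)
  next
    assume k: "of_int k \<in> P"
    show "int l dvd k"
    proof (rule ccontr)
      assume "\<not> int l dvd k"
      \<comment> \<open>By Bezout, an integer in \<open>P\<close> prime to \<open>l\<close> would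
        combine with \<open>l\<close> to put 1 into \<open>P\<close>.\<close>
      then have "coprime (int l) k"
        using l(1) by (simp add: prime_imp_coprime)
      then obtain a b where "a * int l + b * k = 1"
        using bezout_int[of "int l" k] by auto
      then have "of_int (a * int l + b * k) = (1::complex)" by simp
      then have "of_int a * of_nat l + of_int b * of_int k = (1::complex)" by simp
      then show False using P(3)[OF int_mult[OF l(2)] int_mult[OF k]] one by metis
    qed
  qed
  \<comment> \<open>Replacing \<open>omega\<close> by \<open>t\<close> changes an element by a
    multiple of \<open>omega - of_int t\<close>, which lies in \<open>P\<close>; what remains is an
    integer, decided by \<open>int_mem\<close>.\<close>
  have mem: "of_int a + of_int b * omega \<in> P \<longleftrightarrow> int l dvd a + b * t" for a b
  proof -
    have *: "of_int b * (omega - of_int t) \<in> P" by (rule int_mult[OF omega])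
    have "of_int a + of_int b * omega = of_int (a + b * t) + of_int b * (omega - of_int t)"
      by (simp add: algebra_simps)
    then show ?thesis
      using diff[OF _ *, of "of_int a + of_int b * omega"] P(3)[OF _ *, of "of_int (a + b * t)"] int_mem
      by (metis add_diff_cancel_right')
  qed
  \<comment> \<open>Evaluating this element of \<open>P\<close> at \<open>t\<close> gives the
    negative of t^2 + t + 1.\<close>
  have "omega * (omega - of_int t) \<in> P" by (rule P(5)[OF omega])
  moreover have "omega * (omega - of_int t) = of_int (-1) + of_int (- 1 - t) * omega"
    by (simp add: algebra_simps omega_squared)
  ultimately have "int l dvd -1 + (- 1 - t) * t" by (simp only: mem)
  moreover have "-1 + (- 1 - t) * t = - (t\<^sup>2 + t + 1)"
    by (simp add: power2_eq_square algebra_simps)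
  ultimately show t: "int l dvd t\<^sup>2 + t + 1" by (simp only: dvd_minus_iff)
  have mult_mem: "x * y \<in> P" if x: "x \<in> P" and y: "y \<in> eisenstein_integers" for x y
  proof -
    obtain a b where "y = of_int a + of_int b * omega"
      using y unfolding eisenstein_integers_def by blast
    then have "x * y = of_int a * x + of_int b * (omega * x)" by (simp add: algebra_simps)
    then show ?thesis using P(3) int_mult P(5) x by metis
  qed
  interpret R: cring eisenstein_ring by (rule cring_eisenstein_ring)
  have minus: "\<ominus>\<^bsub>eisenstein_ring\<^esub> x = - x" if "x \<in> P" for x
    using that P(1) P(4)[OF that]
    by (intro R.minus_equality) (auto simp: eisenstein_ring_def)
  have "additive_subgroup P eisenstein_ring"
  proof (intro additive_subgroup.intro R.add.subgroupI)
    show "\<ominus>\<^bsub>eisenstein_ring\<^esub> x \<in> P" if "x \<in> P" for x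
      using minus[OF that] P(4)[OF that] by simp
  qed (use P in \<open>auto simp: eisenstein_ring_def\<close>)
  then have ideal: "ideal P eisenstein_ring"
    using mult_mem
    by (intro idealI R.ring_axioms)
       (auto simp: eisenstein_ring_def mult.commute additive_subgroup_def)
  have "primeideal P eisenstein_ring"
  proof (rule primeidealI[OF ideal cring_eisenstein_ring])
    have "1 \<in> eisenstein_integers" using R.one_closed by (simp add: eisenstein_ring_def)
    then show "carrier eisenstein_ring \<noteq> P" using one by (auto simp: eisenstein_ring_def)
    fix x y assume xy: "x \<in> carrier eisenstein_ring" "y \<in> carrier eisenstein_ring"
      "x \<otimes>\<^bsub>eisenstein_ring\<^esub> y \<in> P"
    then obtain a b c d where
      x: "x = of_int a + of_int b * omega" and y: "y = of_int c + of_int d * omega"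
      by (auto simp: eisenstein_ring_def eisenstein_integers_def)
    have "x * y = of_int a * of_int c + (of_int a * of_int d + of_int b * of_int c) * omega
        + of_int b * of_int d * (omega * omega)"
      unfolding x y by (simp add: algebra_simps)
    also have "\<dots> = of_int (a * c - b * d) + of_int (a * d + b * c - b * d) * omega"
      unfolding omega_squared by (simp add: algebra_simps)
    finally have "of_int (a * c - b * d) + of_int (a * d + b * c - b * d) * omega \<in> P"
      using xy(3) unfolding eisenstein_ring_def by simp
    then have "int l dvd (a * c - b * d) + (a * d + b * c - b * d) * t"
      by (simp only: mem)
    \<comment> \<open>Evaluation at \<open>t\<close> respects products only up to a multiple of t^2
      + t + 1, which vanishes modulo \<open>l\<close>.\<close>
    moreover have "(a + b * t) * (c + d * t)
        = (a * c - b * d) + (a * d + b * c - b * d) * t + b * d * (t\<^sup>2 + t + 1)"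
      by (simp add: power2_eq_square algebra_simps)
    ultimately have "int l dvd (a + b * t) * (c + d * t)"
      using t by simp
    then show "x \<in> P \<or> y \<in> P"
      using l(1) unfolding x y mem by (simp add: prime_dvd_mult_iff)
  qed
  moreover have "P \<inter> \<int> = {of_int (int l * k) | k. True}"
  proof (intro equalityI subsetI)
    fix x :: complex assume "x \<in> P \<inter> \<int>"
    then have "x \<in> P" "x \<in> \<int>" by simp_all
    then obtain k where x: "x = of_int k" by (elim Ints_cases)
    with \<open>x \<in> P\<close> have "int l dvd k" by (simp only: int_mem)
    then obtain j where "k = int l * j" by (rule dvdE)
    with x show "x \<in> {of_int (int l * k) | k. True}" by (intro CollectI exI[of _ j]) simp
  next
    fix x :: complex assume "x \<in> {of_int (int l * k) | k. True}"
    then obtain k where x: "x = of_int (int l * k)" by (elim CollectE exE conjE)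
    then have "x \<in> P" by (simp only: int_mem dvd_triv_left)
    moreover have "x \<in> \<int>" unfolding x by (rule Ints_of_int)
    ultimately show "x \<in> P \<inter> \<int>" by (rule IntI)
  qed
  ultimately show "prime_ideal_over P l" by (simp add: prime_ideal_over_def)
qed

section \<open>Similarities and the classification of the pairs\<close>

text \<open>Division by \<open>\<gamma>\<close> is the homothety by 1/\<bar>\<gamma>\<bar> followed
  by multiplication by \<bar>\<gamma>\<bar>/\<gamma>, a complex number of modulus 1 and hence a
  rotation.\<close>

lemma equivalent_pairs_divide:
  assumes "\<gamma> \<noteq> 0"
  shows "equivalent_pairs (L, M) ((\<lambda>z. z / \<gamma>) ` L, (\<lambda>z. z / \<gamma>) ` M)"
proof -
  define T where "T = (\<lambda>z. (of_real (cmod \<gamma>) / \<gamma>) * z)"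
  have "linear T" unfolding T_def by (intro linearI) (auto simp: scaleR_conv_of_real distrib_left)
  then have "orthogonal_transformation T"
    using assms by (auto simp: orthogonal_transformation T_def norm_mult norm_divide)
  moreover have "(\<lambda>v. T (inverse (cmod \<gamma>) *\<^sub>R v)) = (\<lambda>z. z / \<gamma>)"
    using assms by (auto simp: T_def scaleR_conv_of_real field_simps)
  moreover have "inverse (cmod \<gamma>) > 0" using assms by simp
  ultimately show ?thesis unfolding equivalent_pairs_def prod.case by metis
qed

lemma hexagonal_pair:
  assumes "s_and_s'_form 3 3 l L M"
  obtains \<gamma> \<beta> where "\<gamma> \<noteq> 0" "L = (*) \<gamma> ` eisenstein_integers" "M = (*) \<beta> ` eisenstein_integers"
proof -
  from assms obtain c S S' u where c: "c > 0" and index: "sublattice_of_index l L M"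
    and S: "S \<subseteq> (*\<^sub>R) c ` L - (*\<^sub>R) c ` M" "consists_of_pairs 3 S"
    and S': "S' \<subseteq> (*\<^sub>R) c ` M - {0}" "consists_of_pairs 3 S'"
    and minima: "tempered_minima ((*\<^sub>R) c ` L) ((*\<^sub>R) c ` M) S S' (\<lambda>v. v \<bullet> v) u"
    unfolding s_and_s'_form_def tempered_perfect_normalized_def by blast
  have u: "u \<ge> 1" using minima unfolding tempered_minima_def by blast
  have lat: "is_lattice L" "is_lattice M"
    using index unfolding sublattice_of_index_def by auto
  have minM: "v \<bullet> v \<ge> u" if "v \<in> (*\<^sub>R) c ` M" "v \<noteq> 0" for v
    using minima that unfolding tempered_minima_def
    by (metis DiffI order.refl order.strict_implies_order singletonD)
  \<comment> \<open>The minimality condition for \<open>S\<close> speaks only of vectors outside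
    \<open>M\<close>; for those in \<open>M\<close> the bound comes from \<open>u \<ge> 1\<close>.
    So \<open>S\<close> consists of shortest vectors of the whole lattice.\<close>
  have minL: "v \<bullet> v \<ge> 1" if v: "v \<in> (*\<^sub>R) c ` L" "v \<noteq> 0" for v
  proof (cases "v \<in> (*\<^sub>R) c ` M")
    case True
    then show ?thesis using minM v u by fastforce
  next
    case False
    then show ?thesis using minima v unfolding tempered_minima_def
      by (metis DiffI order.refl order.strict_implies_order)
  qed
  obtain \<alpha> where \<alpha>: "\<alpha> \<noteq> 0" "(*\<^sub>R) c ` L = (*) \<alpha> ` eisenstein_integers"
    by (rule hexagonal_lattice[of "(*\<^sub>R) c ` L" 1 S])
       (use scaled_lattice_closed[OF lat(1)] minL S minima in \<open>auto simp: tempered_minima_def\<close>)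
  obtain \<beta> where \<beta>: "\<beta> \<noteq> 0" "(*\<^sub>R) c ` M = (*) \<beta> ` eisenstein_integers"
    by (rule hexagonal_lattice[of "(*\<^sub>R) c ` M" u S'])
       (use scaled_lattice_closed[OF lat(2)] minM S' u minima in \<open>auto simp: tempered_minima_def\<close>)
  \<comment> \<open>The normalizing scalar \<open>c\<close> is absorbed into the generator.\<close>
  have scale: "K = (*) (a / of_real c) ` E" if "(*\<^sub>R) c ` K = (*) a ` E" for K E and a :: complex
  proof -
    have "K = (*\<^sub>R) (inverse c) ` (*\<^sub>R) c ` K" using c by (simp add: image_image)
    also have "\<dots> = (*) (a / of_real c) ` E"
      unfolding that image_image
      by (intro image_cong) (simp_all add: scaleR_conv_of_real divide_inverse mult_ac)
    finally show ?thesis .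
  qed
  show ?thesis
    by (rule that[OF _ scale[OF \<alpha>(2)] scale[OF \<beta>(2)]]) (use \<alpha> c in auto)
qed

theorem corollary7:
  fixes L M :: "complex set" and l :: nat
  assumes "prime l"
    and "s_and_s'_form 3 3 l L M"
  shows "(l = 3 \<or> [l = 1] (mod 6)) \<and>
    (\<exists>P. prime_ideal_over P l \<and> equivalent_pairs (L, M) (eisenstein_integers, P))"
proof -
  obtain \<gamma> \<beta> where \<gamma>: "\<gamma> \<noteq> 0" and LE: "L = (*) \<gamma> ` eisenstein_integers"
    and ME: "M = (*) \<beta> ` eisenstein_integers"
    using hexagonal_pair[OF assms(2)] .
  have L: "is_lattice L" and M: "is_lattice M" "M \<subseteq> L"
    and card: "card (rcosets\<^bsub>additive_group L\<^esub> M) = l"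
    using assms(2) unfolding s_and_s'_form_def sublattice_of_index_def by auto
  note Lc = lattice_closed[OF L] and Mc = lattice_closed[OF M(1)]
  have EI: "of_int a + of_int b * omega \<in> eisenstein_integers" for a b
    unfolding eisenstein_integers_def by blast
  \<comment> \<open>Being a multiple of the Eisenstein integers, \<open>M\<close> is stable under
    \<open>omega\<close> whatever its generator \<open>\<beta>\<close>. This is what turns the
    subgroup \<open>P\<close> below into an ideal.\<close>
  have omega_mult: "omega * x \<in> M" if x: "x \<in> M" for x
  proof -
    obtain a b where "x = \<beta> * (of_int a + of_int b * omega)"
      using x unfolding ME eisenstein_integers_def by blast
    then have "omega * x = \<beta> * (of_int a * omega + of_int b * (omega * omega))"
      by (simp add: algebra_simps)
    also have "\<dots> = \<beta> * (of_int (- b) + of_int (a - b) * omega)"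
      by (simp add: omega_squared algebra_simps)
    finally show ?thesis unfolding ME using EI by blast
  qed
  have \<gamma>L: "\<gamma> \<in> L" "\<gamma> * omega \<in> L"
    using EI[of 1 0] EI[of 0 1] unfolding LE by auto
  \<comment> \<open>Otherwise stability under \<open>omega\<close> would give \<open>M = L\<close>,
    with a single coset, but 1 is not prime.\<close>
  have \<gamma>M: "\<gamma> \<notin> M"
  proof
    assume g: "\<gamma> \<in> M"
    have "x \<in> M" if "x \<in> L" for x
    proof -
      obtain a b where "x = \<gamma> * (of_int a + of_int b * omega)"
        using \<open>x \<in> L\<close> unfolding LE eisenstein_integers_def by blast
      then have "x = of_int a * \<gamma> + of_int b * (omega * \<gamma>)" by (simp add: algebra_simps)
      moreover have "of_int k * y \<in> M" if "y \<in> M" for k y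
        using Mc that by (rule closed_of_int_mult)
      ultimately show ?thesis using g omega_mult[OF g] Mc(2) by metis
    qed
    then have "M = L" using M(2) by blast
    have coset: "L #>\<^bsub>additive_group L\<^esub> x = L" if "x \<in> L" for x
      using that Lc(2) Lc(2)[OF _ Lc(3)[OF that]]
      by (force simp: r_coset_def additive_group_def intro: bexI[where x = "_ + - x"])
    have "rcosets\<^bsub>additive_group L\<^esub> M = {L}"
      unfolding \<open>M = L\<close> RCOSETS_def using coset Lc(1)
      by (auto simp: additive_group_def)
    then show False using card assms(1) by (auto simp: prime_nat_iff)
  qed
  note cyclic = prime_index_cyclic_quotient[OF L M card assms(1) \<gamma>L(1) \<gamma>M]
  \<comment> \<open>The coset of \<open>\<gamma>\<close> generates the quotient; after division by
    \<open>\<gamma>\<close> this says that \<open>omega\<close> is congruent to the integer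
    \<open>k\<close> modulo \<open>P\<close>.\<close>
  obtain k :: nat where k: "\<gamma> * omega - of_nat k * \<gamma> \<in> M"
    using cyclic(2)[OF \<gamma>L(2)] by blast
  define P where "P = (\<lambda>z. z / \<gamma>) ` M"
  have Pmem: "z \<in> P \<longleftrightarrow> \<gamma> * z \<in> M" for z
    using \<gamma> by (force simp: P_def)
  have EL: "(\<lambda>z. z / \<gamma>) ` L = eisenstein_integers"
    using \<gamma> by (simp add: LE image_image)
  have sub: "P \<subseteq> eisenstein_integers" using M(2) EL by (auto simp: P_def)
  have special: "0 \<in> P" "1 \<notin> P" "of_nat l \<in> P" "omega - of_int (int k) \<in> P"
    using Mc(1) \<gamma>M cyclic(1) k by (simp_all add: Pmem algebra_simps)
  have add: "x + y \<in> P" if "x \<in> P" "y \<in> P" for x y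
    using that Mc(2) by (simp add: Pmem distrib_left)
  have neg: "- x \<in> P" if "x \<in> P" for x
    using that Mc(3) by (simp add: Pmem)
  have mult: "omega * x \<in> P" if "x \<in> P" for x
    using that omega_mult[of "\<gamma> * x"] by (simp add: Pmem mult.left_commute)
  have "prime_ideal_over P l"
    by (rule prime_ideal_of_prime_index(1)[OF sub special(1) add neg mult special(2) assms(1) special(3,4)])
  moreover have "int l dvd (int k)\<^sup>2 + int k + 1"
    by (rule prime_ideal_of_prime_index(2)[OF sub special(1) add neg mult special(2) assms(1) special(3,4)])
  moreover have "equivalent_pairs (L, M) (eisenstein_integers, P)"
    using equivalent_pairs_divide[OF \<gamma>, of L M] unfolding EL P_def .
  ultimately show ?thesis using prime_dvd_cyclotomic3[OF assms(1)] by blast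
qed

end
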